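(* Let $\mu$ be a Borel probability measure on $\mathbb{R}^d$ and let $(B_n)_{n\in\mathbb{N}}$ be a sequence of pairwise distinct balls of $\mathbb{R}^d$ with $|B_n|\to0$. (1) If $(B_n)_{n\in\mathbb{N}}$ is $\mu$-a.c., then there exists a $\mu$-a.c. subsequence $(B_{\phi(n)})_{n\in\mathbb{N}}$ which is weakly redundant. (2) If there exists $0\le v<1$ such that $\mu(\limsup_{n\to+\infty}vB_n)=1$, then there exists a $\mu$-a.c. subsequence $(B_{\phi(n)})_{n\in\mathbb{N}}$ verifying $$\underline{\dim}_H(\mu)\le\liminf_{n\to+\infty}\frac{\log\mu(B_{\phi(n)})}{\log|B_{\phi(n)}|}\le\limsup_{n\to+\infty}\frac{\log\mu(B_{\phi(n)})}{\log|B_{\phi(n)}|}\le\overline{\dim}_P(\mu).$$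
   Context: $\mathbb{N}$ includes $0$. $B(x,r)$ ($r>0$) is the closed ball of $(\mathbb{R}^d,\|\cdot\|_\infty)$; balls are such closed balls; $|B|$ is the diameter of $B$; for $t\ge0$, $tB(x,r)=B(x,tr)$. For sets $A_n$, $\limsup_{n\to+\infty}A_n=\bigcap_{g}\bigcup_{n\ge g}A_n$. For $x\in\mathrm{supp}(\mu)$, $\underline{\dim}(\mu,x)=\liminf_{r\to0^+}\frac{\log\mu(B(x,r))}{\log r}$ and $\overline{\dim}(\mu,x)=\limsup_{r\to0^+}\frac{\log\mu(B(x,r))}{\log r}$; $\underline{\dim}_H(\mu)$ is the $\mu$-essential infimum of $x\mapsto\underline{\dim}(\mu,x)$ and $\overline{\dim}_P(\mu)$ is the $\mu$-essential supremum of $x\mapsto\overline{\dim}(\mu,x)$. A sequence of balls $(B_n)_{n\in\mathbb{N}}$ is $\mu$-asymptotically covering ($\mu$-a.c.) if there is a constant $C>0$ such that for every open set $\Omega\subset\mathbb{R}^d$ and every $g\in\mathbb{N}$ there are $N_\Omega\in\mathbb{N}$ (possibly $0$, i.e. the empty family) and integers $g\le n_1\le\dots\le n_{N_\Omega}$ such that: $B_{n_i}\subset\Omega$ for all $1\le i\le N_\Omega$; $B_{n_i}\cap B_{n_j}=\emptyset$ for all $1\le i\ne j\le N_\Omega$; and $\mu\big(\bigcup_{1\le i\le N_\Omega}B_{n_i}\big)\ge C\mu(\Omega)$. A family of balls $\mathcal{B}=(B_n=B(x_n,r_n))_{n\in\mathbb{N}}$ is weakly redundant if, writing $\mathcal{T}_k(\mathcal{B})=\{B_n: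 2^{-k-1}<r_n\le2^{-k}\}$, for every $k\in\mathbb{N}$ there exist an integer $J_k\geq 1$ and a partition $\mathcal{T}_{k,1}(\mathcal{B}),\dots,\mathcal{T}_{k,J_k}(\mathcal{B})$ of $\mathcal{T}_k(\mathcal{B})$ (some parts may be empty) such that for every $1\le j\le J_k$ and every pair $B\ne B'\in\mathcal{T}_{k,j}(\mathcal{B})$ one has $B\cap B'=\emptyset$, and $\lim_{k\to+\infty}\frac{\log_2(J_k)}{k}=0$. *)

theory Defs
  imports "HOL-Probability.Probability"
begin

text \<open>
  Balls are closed balls for the supremum norm, which on \<open>real ^ 'd\<close> is the library's
  \<^const>\<open>infnorm\<close>; \<^const>\<open>cball\<close> and \<^const>\<open>diameter\<close> refer to the Euclidean norm and
  cannot be used. A sequence of balls is given by its centres \<open>x\<close> and radii \<open>r\<close>, so that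
  \<open>t B(x,r)\<close> is \<open>sup_ball x (t * r)\<close>, also for \<open>t = 0\<close> (where it is the singleton of \<open>x\<close>).
\<close>

definition sup_ball :: "real ^ 'd \<Rightarrow> real \<Rightarrow> (real ^ 'd) set" where
  "sup_ball x r = {y. infnorm (y - x) \<le> r}"

definition sup_diameter :: "(real ^ 'd) set \<Rightarrow> real" where
  "sup_diameter S = (if S = {} then 0 else (SUP (y, z) \<in> S \<times> S. infnorm (y - z)))"

lemma sup_diameter_sup_ball:
  fixes x :: "real ^ 'd"
  assumes "0 \<le> r"
  shows "sup_diameter (sup_ball x r) = 2 * r"
proof -
  define e :: "real ^ 'd" where "e = (\<chi> i. r)"
  have e: "infnorm e = r"
    using assms by (simp add: infnorm_cart e_def)
  have ends: "x + e \<in> sup_ball x r" "x - e \<in> sup_ball x r"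
    using e infnorm_neg[of e] by (simp_all add: sup_ball_def)
  have "infnorm ((x + e) - (x - e)) = infnorm (2 *\<^sub>R e)"
    by (simp add: scaleR_2)
  then have attained: "infnorm ((x + e) - (x - e)) = 2 * r"
    using e by (simp add: infnorm_mul)
  have upper: "infnorm (y - z) \<le> 2 * r" if "y \<in> sup_ball x r" "z \<in> sup_ball x r" for y z
    using infnorm_triangle[of "y - x" "x - z"] infnorm_sub[of x z] that
    by (simp add: sup_ball_def)
  have "(SUP (y, z) \<in> sup_ball x r \<times> sup_ball x r. infnorm (y - z)) = 2 * r"
  proof (rule cSup_eq_maximum)
    show "2 * r \<in> (\<lambda>(y, z). infnorm (y - z)) ` (sup_ball x r \<times> sup_ball x r)"
      using ends attained by (intro image_eqI[of _ _ "(x + e, x - e)"]) auto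
  qed (use upper in auto)
  then show ?thesis
    using ends by (auto simp: sup_diameter_def)
qed

text \<open>
  The real function \<^const>\<open>ln\<close> has \<open>ln 0 = 0\<close>; here \<open>log 0\<close> is minus infinity, so that
  \<open>log_ratio 0 s\<close> is plus infinity whenever \<open>0 < s < 1\<close>.
\<close>

definition log_ereal :: "real \<Rightarrow> ereal" where
  "log_ereal t = (if t = 0 then - \<infinity> else ereal (ln t))"

definition log_ratio :: "real \<Rightarrow> real \<Rightarrow> ereal" where
  "log_ratio m s = log_ereal m / log_ereal s"

definition lower_local_dim :: "(real ^ 'd) measure \<Rightarrow> real ^ 'd \<Rightarrow> ereal" where
  "lower_local_dim M x = Liminf (at_right 0) (\<lambda>r. log_ratio (measure M (sup_ball x r)) r)"

definition upper_local_dim :: "(real ^ 'd) measure \<Rightarrow> real ^ 'd \<Rightarrow> ereal" where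
  "upper_local_dim M x = Limsup (at_right 0) (\<lambda>r. log_ratio (measure M (sup_ball x r)) r)"

text \<open>
  The essential infimum and supremum are the \<^const>\<open>Liminf\<close> and \<^const>\<open>Limsup\<close> along
  \<^const>\<open>ae_filter\<close>, as in the library's \<^const>\<open>esssup\<close>, but without the default value that
  \<^const>\<open>esssup\<close> takes on non-measurable functions. The local dimensions are total functions
  here (with value plus infinity off the support); this is harmless because the complement
  of the support of a finite Borel measure is a null set.
\<close>

definition lower_dim_H :: "(real ^ 'd) measure \<Rightarrow> ereal" where
  "lower_dim_H M = Liminf (ae_filter M) (lower_local_dim M)"

definition upper_dim_P :: "(real ^ 'd) measure \<Rightarrow> ereal" where
  "upper_dim_P M = Limsup (ae_filter M) (upper_local_dim M)"

definition asymptotically_covering ::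
    "(real ^ 'd) measure \<Rightarrow> (nat \<Rightarrow> real ^ 'd) \<Rightarrow> (nat \<Rightarrow> real) \<Rightarrow> bool" where
  "asymptotically_covering M x r \<longleftrightarrow>
    (\<exists>C>0. \<forall>\<Omega>. open \<Omega> \<longrightarrow> (\<forall>g::nat. \<exists>N::nat. \<exists>n::nat \<Rightarrow> nat.
       (\<forall>i\<in>{1..N}. g \<le> n i) \<and> mono_on {1..N} n \<and>
       (\<forall>i\<in>{1..N}. sup_ball (x (n i)) (r (n i)) \<subseteq> \<Omega>) \<and>
       (\<forall>i\<in>{1..N}. \<forall>j\<in>{1..N}. i \<noteq> j \<longrightarrow>
          sup_ball (x (n i)) (r (n i)) \<inter> sup_ball (x (n j)) (r (n j)) = {}) \<and>
       measure M (\<Union>i\<in>{1..N}. sup_ball (x (n i)) (r (n i))) \<ge> C * measure M \<Omega>))"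

definition scale_class ::
    "(nat \<Rightarrow> real ^ 'd) \<Rightarrow> (nat \<Rightarrow> real) \<Rightarrow> nat \<Rightarrow> (real ^ 'd) set set" where
  "scale_class x r k =
    {sup_ball (x n) (r n) | n. 2 powr (- real k - 1) < r n \<and> r n \<le> 2 powr (- real k)}"

definition weakly_redundant :: "(nat \<Rightarrow> real ^ 'd) \<Rightarrow> (nat \<Rightarrow> real) \<Rightarrow> bool" where
  "weakly_redundant x r \<longleftrightarrow>
    (\<exists>(J :: nat \<Rightarrow> nat) (T :: nat \<Rightarrow> nat \<Rightarrow> (real ^ 'd) set set).
       (\<forall>k. 1 \<le> J k \<and>
            (\<Union>j\<in>{1..J k}. T k j) = scale_class x r k \<and>
            disjoint_family_on (T k) {1..J k} \<and>
            (\<forall>j\<in>{1..J k}. \<forall>B\<in>T k j. \<forall>B'\<in>T k j. B \<noteq> B' \<longrightarrow> B \<inter> B' = {})) \<and>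
       (\<lambda>k. log 2 (real (J k)) / real k) \<longlonglongrightarrow> 0)"

end

theory Submission
  imports Defs "HOL-Real_Asymp.Real_Asymp"
begin

text \<open>
  Both parts extract the subsequence by one diagonal construction. Suppose that, with a
  constant \<open>C\<close> independent of \<open>p\<close>, the balls with index in \<open>G p\<close> have the covering property.
  A countable sequence of open sets approximates every open set from inside in measure. At stage
  \<open>p\<close> one picks, for each of the first \<open>p + 1\<close> of these open sets, a finite disjoint family of
  balls with index in \<open>G p\<close> which covers the proportion \<open>C\<close> of it, and one takes the balls so far
  along the sequence that their radii are less than half of all those used before. The balls
  picked at all the stages have the covering property with the constant \<open>C / 2\<close>
  (\<open>sparse_covering_family\<close>). All the balls of one dyadic scale belong to a single stage, and
  those of scale \<open>k\<close> to a stage \<open>p \<le> k\<close>, so they split into at most \<open>k + 1\<close> disjoint families.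
  With \<open>G p\<close> the set of all indices, this gives the weak redundancy in the first part.

  In the second part, \<open>G p\<close> consists of the indices \<open>n\<close> for which the ratio of \<open>log \<mu>(B\<^sub>n)\<close> and
  \<open>log \<bar>B\<^sub>n\<bar>\<close> lies between \<open>a p\<close> and \<open>b p\<close>, which tend to the two dimensions from below and from
  above. If \<open>z\<close> lies in \<open>v B\<^sub>n\<close>, then \<open>B\<^sub>n\<close> lies between two balls around \<open>z\<close> whose radii are
  constant multiples of \<open>r\<^sub>n\<close>; hence, for almost every \<open>z\<close>, all but finitely many of the \<open>n\<close> with
  \<open>z \<in> v B\<^sub>n\<close> are in \<open>G p\<close>, and the limsup set of the \<open>v B\<^sub>n\<close> with \<open>n \<in> G p\<close> still has full measure.

  It remains to see that a limsup set of full measure implies the covering property, with a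
  constant that depends on \<open>v\<close> and on the dimension only (\<open>covering_family_if_limsup_full\<close>). Since
  finitely many of the balls \<open>v B\<^sub>n\<close> inside an open set already cover half of its measure, this
  follows from a Besicovitch covering lemma for finite families (\<open>select_and_colour\<close>). Going
  through the balls in the order of decreasing radius, one keeps a ball if \<open>v B\<^sub>n\<close> is not yet
  covered by the balls kept before, and marks a point of \<open>v B\<^sub>n\<close> that is not covered. The number
  of kept balls that contain a given point \<open>z\<close> is bounded: those with marked points in one orthant
  at \<open>z\<close> have comparable radii, and their marked points are at distances from each other which
  are at least a constant multiple of these radii. A cube that meets a smaller one contains one of the corners of the smaller one, so a ball meets boundedly
  many of those kept before it. The kept balls can therefore be coloured with boundedly many
  colours in such a way that balls of one colour are disjoint, and one of the colours
  carries a fixed proportion of the measure.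
\<close>

section \<open>Balls for the supremum norm\<close>

lemma mem_sup_ball: "y \<in> sup_ball x r \<longleftrightarrow> (\<forall>k. \<bar>y $ k - x $ k\<bar> \<le> r)"
proof -
  have "infnorm (y - x) \<le> r \<longleftrightarrow> (\<forall>k. \<bar>(y - x) $ k\<bar> \<le> r)"
  proof
    show "\<forall>k. \<bar>(y - x) $ k\<bar> \<le> r" if "infnorm (y - x) \<le> r"
      using that component_le_infnorm_cart order_trans by blast
    show "infnorm (y - x) \<le> r" if "\<forall>k. \<bar>(y - x) $ k\<bar> \<le> r"
      unfolding infnorm_cart by (rule cSup_least) (use that in auto)
  qed
  then show ?thesis
    by (simp add: sup_ball_def)
qed

lemma sup_ball_mono: "r \<le> s \<Longrightarrow> sup_ball x r \<subseteq> sup_ball x s"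
  by (auto simp: sup_ball_def)

lemma sup_ball_subset_sup_ball:
  assumes "y \<in> sup_ball x t" "s + t \<le> r"
  shows "sup_ball y s \<subseteq> sup_ball x r"
proof
  fix w assume w: "w \<in> sup_ball y s"
  have "\<bar>w $ k - x $ k\<bar> \<le> r" for k
  proof -
    have "\<bar>w $ k - y $ k\<bar> \<le> s" "\<bar>y $ k - x $ k\<bar> \<le> t"
      using w assms(1) by (auto simp: mem_sup_ball)
    then show ?thesis using assms(2) by linarith
  qed
  then show "w \<in> sup_ball x r"
    by (simp add: mem_sup_ball)
qed

lemma closed_sup_ball: "closed (sup_ball x r)"
  unfolding sup_ball_def by (intro closed_Collect_le continuous_intros)

lemma open_contains_sup_ball:
  fixes x :: "real ^ 'd"
  assumes "open U" "x \<in> U"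
  obtains e where "0 < e" "sup_ball x e \<subseteq> U"
proof -
  obtain e where e: "0 < e" "cball x e \<subseteq> U"
    using assms open_contains_cball by blast
  define c where "c = sqrt (DIM(real ^ 'd))"
  have c: "0 < c"
    by (simp add: c_def)
  have "sup_ball x (e / c) \<subseteq> cball x e"
  proof
    fix y assume "y \<in> sup_ball x (e / c)"
    then have "c * infnorm (y - x) \<le> e"
      using c by (simp add: sup_ball_def field_simps)
    moreover have "norm (y - x) \<le> c * infnorm (y - x)"
      unfolding c_def by (rule norm_le_infnorm)
    ultimately show "y \<in> cball x e"
      by (simp add: dist_norm norm_minus_commute)
  qed
  with e c show ?thesis
    by (intro that[of "e / c"]) auto
qed

section \<open>Bounded overlap\<close>

text \<open>
  The combinatorial condition under which overlaps are counted. It is symmetric in the two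
  balls: the marked point \<open>y n\<close> of each ball lies in its contraction by the factor \<open>v\<close>, and
  of any two balls the larger one misses the marked point of the other (when the radii agree, one
  of the two does).
\<close>

definition marked_balls ::
    "real \<Rightarrow> (nat \<Rightarrow> real ^ 'd) \<Rightarrow> (nat \<Rightarrow> real) \<Rightarrow> (nat \<Rightarrow> real ^ 'd) \<Rightarrow> nat set \<Rightarrow> bool" where
  "marked_balls v x r y S \<longleftrightarrow>
     (\<forall>n\<in>S. 0 < r n \<and> y n \<in> sup_ball (x n) (v * r n)) \<and>
     (\<forall>m\<in>S. \<forall>n\<in>S. m \<noteq> n \<longrightarrow>
        (r n \<le> r m \<and> y n \<notin> sup_ball (x m) (r m)) \<or>
        (r m \<le> r n \<and> y m \<notin> sup_ball (x n) (r n)))"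

lemma marked_balls_subset: "marked_balls v x r y S \<Longrightarrow> T \<subseteq> S \<Longrightarrow> marked_balls v x r y T"
  unfolding marked_balls_def by blast

lemma marked_points_separated:
  assumes "marked_balls v x r y S" "m \<in> S" "n \<in> S" "m \<noteq> n" "v < 1"
    and "s \<le> r m" "s \<le> r n"
  shows "\<exists>k. (1 - v) * s < \<bar>y m $ k - y n $ k\<bar>"
proof -
  have *: "\<exists>k. (1 - v) * s < \<bar>y i $ k - y j $ k\<bar>"
    if i: "y i \<notin> sup_ball (x j) (r j)" and j: "j \<in> S" "s \<le> r j" for i j
  proof -
    from i obtain k where k: "r j < \<bar>y i $ k - x j $ k\<bar>"
      by (auto simp: mem_sup_ball not_le)
    have "\<bar>y j $ k - x j $ k\<bar> \<le> v * r j"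
      using assms(1) j by (auto simp: marked_balls_def mem_sup_ball)
    with k have "(1 - v) * r j < \<bar>y i $ k - y j $ k\<bar>"
      by (simp add: left_diff_distrib)
    moreover have "(1 - v) * s \<le> (1 - v) * r j"
      using j assms(5) by (intro mult_left_mono) auto
    ultimately have "(1 - v) * s < \<bar>y i $ k - y j $ k\<bar>"
      by linarith
    then show ?thesis by blast
  qed
  have "y n \<notin> sup_ball (x m) (r m) \<or> y m \<notin> sup_ball (x n) (r n)"
    using assms(1-4) unfolding marked_balls_def by blast
  then show ?thesis
    using *[of n m] *[of m n] assms by (auto simp: abs_minus_commute)
qed

text \<open>
  Within one orthant at a common point \<open>z\<close>, a ball of the family cannot be much smaller than
  the largest one: if the marked point of the small ball were close to \<open>z\<close>, it would lie in
  the box spanned by \<open>z\<close> and the marked point of the large ball together with a margin, hence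
  in the large ball.
\<close>

lemma marked_radius_lower_bound:
  assumes S: "marked_balls v x r y S" and ij: "i \<in> S" "j \<in> S" "r i \<le> r j"
    and v: "0 \<le> v" "v < 1"
    and z: "z \<in> sup_ball (x i) (r i)" "z \<in> sup_ball (x j) (r j)"
    and orthant: "\<And>k. z $ k \<le> y i $ k \<longleftrightarrow> z $ k \<le> y j $ k"
  shows "(1 - v) / 2 * r j \<le> r i"
proof (cases "i = j \<or> r j \<le> r i")
  case True
  have "0 < r i" "0 < r j"
    using S ij by (auto simp: marked_balls_def)
  moreover have "r i = r j"
    using True ij by auto
  moreover have "(1 - v) / 2 * r j \<le> 1 * r j"
    using v \<open>0 < r j\<close> by (intro mult_right_mono) auto
  ultimately show ?thesis by simp
next
  case False
  then have "y i \<notin> sup_ball (x j) (r j)"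
    using S ij unfolding marked_balls_def by fastforce
  then obtain k where k: "r j < \<bar>y i $ k - x j $ k\<bar>"
    by (auto simp: mem_sup_ball not_le)
  have comp: "\<bar>y i $ k - x i $ k\<bar> \<le> v * r i" "\<bar>y j $ k - x j $ k\<bar> \<le> v * r j"
      "\<bar>z $ k - x i $ k\<bar> \<le> r i" "\<bar>z $ k - x j $ k\<bar> \<le> r j"
    using S ij z by (auto simp: marked_balls_def mem_sup_ball)
  have "r j - v * r j < \<bar>y i $ k - z $ k\<bar>"
    using k comp orthant[of k] by linarith
  moreover have "v * r i \<le> 1 * r i"
    using v S ij by (intro mult_right_mono) (auto simp: marked_balls_def)
  moreover have "\<bar>y i $ k - z $ k\<bar> \<le> v * r i + r i"
    using comp by linarith
  ultimately show ?thesis by (simp add: algebra_simps)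
qed

text \<open>
  The marked points of the balls that contain \<open>z\<close> and have their marked point in a given orthant
  at \<open>z\<close> are counted with a cubic grid centred at \<open>z\<close>: in units of its mesh, their coordinates
  relative to \<open>z\<close> are at most \<open>4 / (1 - v)\<^sup>2\<close> in absolute value. The factor \<open>2 ^ d\<close> below is
  the number of orthants.
\<close>

definition grid_size :: "real \<Rightarrow> int" where
  "grid_size v = \<lceil>4 / (1 - v)\<^sup>2\<rceil>"

definition overlap_bound :: "real \<Rightarrow> nat \<Rightarrow> nat" where
  "overlap_bound v d = 2 ^ d * nat (2 * grid_size v + 1) ^ d"

lemma card_marked_balls_in_orthant:
  fixes z :: "real ^ 'd"
  assumes S: "marked_balls v x r y S" "finite S" and v: "0 \<le> v" "v < 1"
    and z: "\<And>n. n \<in> S \<Longrightarrow> z \<in> sup_ball (x n) (r n)"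
    and orthant: "\<And>n k. n \<in> S \<Longrightarrow> z $ k \<le> y n $ k \<longleftrightarrow> k \<in> U"
  shows "card S \<le> nat (2 * grid_size v + 1) ^ CARD('d)"
proof (cases "S = {}")
  case False
  define R where "R = Max (r ` S)"
  have "R \<in> r ` S"
    unfolding R_def using S False by (intro Max_in) auto
  then obtain j where j: "j \<in> S" "r j = R"
    by auto
  have le_R: "r i \<le> R" if "i \<in> S" for i
    unfolding R_def using that S by auto
  have R: "0 < R"
    using S j by (auto simp: marked_balls_def)
  have ge_R: "(1 - v) / 2 * R \<le> r i" if "i \<in> S" for i
    using marked_radius_lower_bound[OF S(1) that j(1) _ v z[OF that] z[OF j(1)]]
      orthant that j le_R by auto
  define \<delta> where "\<delta> = (1 - v)\<^sup>2 / 2 * R"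
  have \<delta>: "0 < \<delta>" "2 * R / \<delta> = 4 / (1 - v)\<^sup>2"
    using R v by (auto simp: \<delta>_def field_simps)
  \<comment> \<open>The grid cells of side \<open>\<delta>\<close> are small enough to separate the marked points.\<close>
  define cell where "cell n k = \<lfloor>(y n $ k - z $ k) / \<delta>\<rfloor>" for n k
  have "inj_on cell S"
  proof (rule inj_onI, rule ccontr)
    fix m n assume mn: "m \<in> S" "n \<in> S" "cell m = cell n" "m \<noteq> n"
    obtain k where "(1 - v) * ((1 - v) / 2 * R) < \<bar>y m $ k - y n $ k\<bar>"
      using marked_points_separated[OF S(1) mn(1,2,4) v(2) ge_R ge_R] mn by blast
    then have "\<delta> < \<bar>y m $ k - y n $ k\<bar>"
      by (simp add: \<delta>_def power2_eq_square algebra_simps)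
    then have "1 < \<bar>(y m $ k - y n $ k) / \<delta>\<bar>"
      using \<delta> by (simp add: field_simps)
    also have "(y m $ k - y n $ k) / \<delta> = (y m $ k - z $ k) / \<delta> - (y n $ k - z $ k) / \<delta>"
      by (simp add: diff_divide_distrib)
    finally have "cell m k \<noteq> cell n k"
      unfolding cell_def by linarith
    with mn show False by simp
  qed
  moreover have "cell ` S \<subseteq> (UNIV :: 'd set) \<rightarrow>\<^sub>E {- grid_size v..grid_size v}"
  proof (clarsimp simp: PiE_UNIV_domain)
    fix n k assume n: "n \<in> S"
    have "\<bar>y n $ k - x n $ k\<bar> \<le> v * r n" "\<bar>z $ k - x n $ k\<bar> \<le> r n"
      using S n z by (auto simp: marked_balls_def mem_sup_ball)
    moreover have "v * r n \<le> 1 * r n"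
      using v S n by (intro mult_right_mono) (auto simp: marked_balls_def)
    ultimately have "\<bar>y n $ k - z $ k\<bar> \<le> 2 * R"
      using le_R[OF n] by linarith
    then have "\<bar>(y n $ k - z $ k) / \<delta>\<bar> \<le> 4 / (1 - v)\<^sup>2"
      unfolding \<delta>(2)[symmetric] using \<delta>(1) by (simp add: divide_right_mono)
    then show "- grid_size v \<le> cell n k \<and> cell n k \<le> grid_size v"
      unfolding cell_def grid_size_def by linarith
  qed
  ultimately have "card S \<le> card ((UNIV :: 'd set) \<rightarrow>\<^sub>E {- grid_size v..grid_size v})"
    by (intro card_inj_on_le) (auto intro: finite_PiE)
  also have "\<dots> = nat (2 * grid_size v + 1) ^ CARD('d)"
    by (simp add: card_PiE algebra_simps)
  finally show ?thesis .
qed simp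

lemma card_marked_balls_at_point:
  fixes z :: "real ^ 'd"
  assumes S: "marked_balls v x r y S" "finite S" and v: "0 \<le> v" "v < 1"
    and z: "\<And>n. n \<in> S \<Longrightarrow> z \<in> sup_ball (x n) (r n)"
  shows "card S \<le> overlap_bound v CARD('d)"
proof -
  define part where "part U = {n \<in> S. {k. z $ k \<le> y n $ k} = U}" for U
  have "S = (\<Union>U. part U)"
    by (auto simp: part_def)
  then have "card S \<le> (\<Sum>U\<in>UNIV. card (part U))"
    by (metis card_UN_le finite)
  also have "\<dots> \<le> (\<Sum>U\<in>(UNIV :: 'd set set). nat (2 * grid_size v + 1) ^ CARD('d))"
  proof (rule sum_mono)
    fix U :: "'d set"
    show "card (part U) \<le> nat (2 * grid_size v + 1) ^ CARD('d)"
    proof (rule card_marked_balls_in_orthant[where U = U, OF _ _ v])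
      show "marked_balls v x r y (part U)"
        using S(1) by (rule marked_balls_subset) (auto simp: part_def)
    qed (use S z in \<open>auto simp: part_def\<close>)
  qed
  also have "\<dots> = overlap_bound v CARD('d)"
    by (simp add: overlap_bound_def card_Pow flip: Pow_UNIV)
  finally show ?thesis .
qed

text \<open>
  This is where the supremum norm is convenient: a cube that meets a cube which is not larger
  contains one of its corners.
\<close>

lemma larger_sup_ball_contains_corner:
  fixes x x' :: "real ^ 'd"
  assumes "0 \<le> r" "r \<le> r'" "sup_ball x r \<inter> sup_ball x' r' \<noteq> {}"
  shows "\<exists>U. (\<chi> k. if k \<in> U then x $ k + r else x $ k - r) \<in> sup_ball x' r'"
proof -
  obtain w where w: "w \<in> sup_ball x r" "w \<in> sup_ball x' r'"
    using assms by blast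
  have "\<bar>(if x $ k \<le> x' $ k then x $ k + r else x $ k - r) - x' $ k\<bar> \<le> r'" for k
  proof -
    have "\<bar>w $ k - x $ k\<bar> \<le> r" "\<bar>w $ k - x' $ k\<bar> \<le> r'"
      using w by (auto simp: mem_sup_ball)
    then show ?thesis using assms(1,2) by auto
  qed
  then show ?thesis
    by (intro exI[of _ "{k. x $ k \<le> x' $ k}"]) (simp add: mem_sup_ball)
qed

lemma card_marked_balls_meeting:
  fixes x :: "nat \<Rightarrow> real ^ 'd"
  assumes S: "marked_balls v x r y S" "finite S" and v: "0 \<le> v" "v < 1"
    and s: "0 \<le> s" and meet: "\<And>n. n \<in> S \<Longrightarrow> s \<le> r n \<and> sup_ball w s \<inter> sup_ball (x n) (r n) \<noteq> {}"
  shows "card S \<le> 2 ^ CARD('d) * overlap_bound v CARD('d)"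
proof -
  define part where
    "part U = {n \<in> S. (\<chi> k. if k \<in> U then w $ k + s else w $ k - s) \<in> sup_ball (x n) (r n)}" for U
  have "S = (\<Union>U. part U)"
    using larger_sup_ball_contains_corner[OF s] meet by (fastforce simp: part_def)
  then have "card S \<le> (\<Sum>U\<in>UNIV. card (part U))"
    by (metis card_UN_le finite)
  also have "\<dots> \<le> (\<Sum>U\<in>(UNIV :: 'd set set). overlap_bound v CARD('d))"
  proof (rule sum_mono)
    fix U :: "'d set"
    show "card (part U) \<le> overlap_bound v CARD('d)"
    proof (rule card_marked_balls_at_point[OF _ _ v])
      show "marked_balls v x r y (part U)"
        using S(1) by (rule marked_balls_subset) (auto simp: part_def)
    qed (use S in \<open>auto simp: part_def\<close>)
  qed
  also have "\<dots> = 2 ^ CARD('d) * overlap_bound v CARD('d)"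
    by (simp add: card_Pow flip: Pow_UNIV)
  finally show ?thesis .
qed

section \<open>Disjoint subfamilies of large measure\<close>

text \<open>
  One colour more than the number of larger kept balls that can meet a given ball: \<open>2 ^ d\<close>
  corners, each of them in at most \<open>overlap_bound v d\<close> balls.
\<close>

definition colour_number :: "real \<Rightarrow> nat \<Rightarrow> nat" where
  "colour_number v d = Suc (2 ^ d * overlap_bound v d)"

text \<open>
  A Besicovitch covering lemma for finite families. The balls are treated in the order of
  decreasing radius; a ball is kept if its contraction is not yet covered, and it is then given
  a colour that none of the kept balls that meet it has.
\<close>

lemma select_and_colour:
  fixes x :: "nat \<Rightarrow> real ^ 'd"
  assumes v: "0 \<le> v" "v < 1" and r: "\<And>n. 0 < r n" and A: "finite A"
  shows "\<exists>S y c. S \<subseteq> A \<and> marked_balls v x r y S \<and>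
    (\<forall>n\<in>S. c n < colour_number v CARD('d)) \<and>
    (\<forall>m\<in>S. \<forall>n\<in>S. m \<noteq> n \<longrightarrow> c m = c n \<longrightarrow> sup_ball (x m) (r m) \<inter> sup_ball (x n) (r n) = {}) \<and>
    (\<Union>n\<in>A. sup_ball (x n) (v * r n)) \<subseteq> (\<Union>n\<in>S. sup_ball (x n) (r n))"
  using A
proof (induction A rule: finite_ranking_induct[where f = "\<lambda>n. - r n"])
  case empty
  show ?case
    by (rule exI[of _ "{}"]) (simp add: marked_balls_def)
next
  case (insert n A)
  then obtain S y and c :: "nat \<Rightarrow> nat" where S: "S \<subseteq> A" "marked_balls v x r y S"
    and c: "\<And>n. n \<in> S \<Longrightarrow> c n < colour_number v CARD('d)"
      "\<And>m n. m \<in> S \<Longrightarrow> n \<in> S \<Longrightarrow> m \<noteq> n \<Longrightarrow> c m = c n \<Longrightarrow>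
         sup_ball (x m) (r m) \<inter> sup_ball (x n) (r n) = {}"
    and cover: "(\<Union>n\<in>A. sup_ball (x n) (v * r n)) \<subseteq> (\<Union>n\<in>S. sup_ball (x n) (r n))"
    by (elim exE conjE) blast
  show ?case
  proof (cases "sup_ball (x n) (v * r n) \<subseteq> (\<Union>m\<in>S. sup_ball (x m) (r m))")
    case True
    then show ?thesis
      using S c cover by (intro exI[of _ S] exI[of _ y] exI[of _ c]) auto
  next
    case False
    then obtain p where p: "p \<in> sup_ball (x n) (v * r n)"
        "\<And>m. m \<in> S \<Longrightarrow> p \<notin> sup_ball (x m) (r m)"
      by blast
    have "v * r n \<le> 1 * r n"
      using v r[of n] by (intro mult_right_mono) auto
    then have sub: "sup_ball (x n) (v * r n) \<subseteq> sup_ball (x n) (r n)"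
      by (intro sup_ball_mono) simp
    then have n: "n \<notin> S"
      using p by blast
    have le: "r n \<le> r m" if "m \<in> S" for m
      using insert.hyps(2)[of m] that S(1) by auto
    have fin: "finite S"
      using S(1) insert.hyps(1) finite_subset by blast
    define N where "N = {m \<in> S. sup_ball (x n) (r n) \<inter> sup_ball (x m) (r m) \<noteq> {}}"
    have "card N \<le> 2 ^ CARD('d) * overlap_bound v CARD('d)"
    proof (rule card_marked_balls_meeting[OF _ _ v])
      show "marked_balls v x r y N"
        using S(2) by (rule marked_balls_subset) (auto simp: N_def)
      show "0 \<le> r n"
        using r[of n] by simp
    qed (use fin le in \<open>auto simp: N_def\<close>)
    then have "card (c ` N) < card {..<colour_number v CARD('d)}"
      using card_image_le[of N c] fin by (simp add: colour_number_def N_def)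
    then have "\<not> {..<colour_number v CARD('d)} \<subseteq> c ` N"
      using card_mono[of "c ` N" "{..<colour_number v CARD('d)}"] fin by (auto simp: N_def)
    then obtain q where q: "q < colour_number v CARD('d)" "q \<notin> c ` N"
      by auto
    have marked: "marked_balls v x r (y(n := p)) (insert n S)"
      using S(2) p le n r unfolding marked_balls_def by auto
    have disj: "sup_ball (x i) (r i) \<inter> sup_ball (x j) (r j) = {}"
      if "i \<in> insert n S" "j \<in> insert n S" "i \<noteq> j" "(c(n := q)) i = (c(n := q)) j" for i j
    proof -
      have "sup_ball (x n) (r n) \<inter> sup_ball (x m) (r m) = {}" if "m \<in> S" "c m = q" for m
        using that q(2) by (auto simp: N_def)
      then show ?thesis
        using that c(2)[of i j] n by (fastforce split: if_splits)
    qed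
    show ?thesis
    proof (intro exI conjI)
      show "marked_balls v x r (y(n := p)) (insert n S)"
        by (rule marked)
      show "insert n S \<subseteq> insert n A"
        using S(1) by auto
      show "\<forall>i\<in>insert n S. (c(n := q)) i < colour_number v CARD('d)"
        using c(1) q(1) by auto
      show "\<forall>i\<in>insert n S. \<forall>j\<in>insert n S. i \<noteq> j \<longrightarrow> (c(n := q)) i = (c(n := q)) j \<longrightarrow>
          sup_ball (x i) (r i) \<inter> sup_ball (x j) (r j) = {}"
        using disj by blast
      show "(\<Union>i\<in>insert n A. sup_ball (x i) (v * r i)) \<subseteq> (\<Union>i\<in>insert n S. sup_ball (x i) (r i))"
        using cover sub by auto
    qed
  qed
qed

lemma disjoint_subfamily_large_measure:
  fixes M :: "(real ^ 'd) measure" and A :: "nat set"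
  assumes M: "finite_measure M" "sets M = sets borel"
    and v: "0 \<le> v" "v < 1" and r: "\<And>n. 0 < r n" and A: "finite A"
  shows "\<exists>T\<subseteq>A. disjoint_family_on (\<lambda>n. sup_ball (x n) (r n)) T \<and>
    measure M (\<Union>n\<in>A. sup_ball (x n) (v * r n))
      \<le> real (colour_number v CARD('d)) * measure M (\<Union>n\<in>T. sup_ball (x n) (r n))"
proof -
  interpret finite_measure M by (rule M)
  have [measurable]: "sup_ball p s \<in> sets M" for p s
    unfolding M(2) by (rule borel_closed[OF closed_sup_ball])
  define Q where "Q = colour_number v CARD('d)"
  obtain S y c where S: "S \<subseteq> A" "marked_balls v x r y S"
    and c: "\<forall>n\<in>S. c n < Q"
      "\<forall>m\<in>S. \<forall>n\<in>S. m \<noteq> n \<longrightarrow> c m = c n \<longrightarrow>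
         sup_ball (x m) (r m) \<inter> sup_ball (x n) (r n) = {}"
    and cover: "(\<Union>n\<in>A. sup_ball (x n) (v * r n)) \<subseteq> (\<Union>n\<in>S. sup_ball (x n) (r n))"
    using select_and_colour[where x = x and r = r, OF v r A, folded Q_def]
    by (elim exE conjE) (rule that)
  have fin: "finite S"
    using S(1) A finite_subset by blast
  define U where "U q = (\<Union>n\<in>{n \<in> S. c n = q}. sup_ball (x n) (r n))" for q
  have [measurable]: "U q \<in> sets M" for q
    unfolding U_def using fin by (intro sets.finite_UN) auto
  have "(\<Union>n\<in>S. sup_ball (x n) (r n)) \<subseteq> (\<Union>q<Q. U q)"
    unfolding U_def using c(1) by blast
  moreover have "(\<Union>q<Q. U q) \<in> sets M"
    by (intro sets.finite_UN) auto
  ultimately have "measure M (\<Union>n\<in>A. sup_ball (x n) (v * r n)) \<le> measure M (\<Union>q<Q. U q)"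
    by (intro finite_measure_mono order_trans[OF cover])
  also have "\<dots> \<le> (\<Sum>q<Q. measure M (U q))"
    by (intro finite_measure_subadditive_finite) auto
  finally have sum: "measure M (\<Union>n\<in>A. sup_ball (x n) (v * r n)) \<le> (\<Sum>q<Q. measure M (U q))" .
  have "\<exists>q<Q. measure M (\<Union>n\<in>A. sup_ball (x n) (v * r n)) \<le> real Q * measure M (U q)"
  proof (rule ccontr)
    assume "\<not> ?thesis"
    then have less: "real Q * measure M (U q) < measure M (\<Union>n\<in>A. sup_ball (x n) (v * r n))"
      if "q < Q" for q
      using that by (auto simp: not_le)
    have "0 < Q"
      by (simp add: Q_def colour_number_def)
    have "real Q * (\<Sum>q<Q. measure M (U q)) = (\<Sum>q<Q. real Q * measure M (U q))"
      by (rule sum_distrib_left)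
    also have "\<dots> < (\<Sum>q<Q. measure M (\<Union>n\<in>A. sup_ball (x n) (v * r n)))"
      using less \<open>0 < Q\<close> by (intro sum_strict_mono) auto
    also have "\<dots> = real Q * measure M (\<Union>n\<in>A. sup_ball (x n) (v * r n))"
      by simp
    finally show False
      using sum \<open>0 < Q\<close> by simp
  qed
  then obtain q where q: "measure M (\<Union>n\<in>A. sup_ball (x n) (v * r n)) \<le> real Q * measure M (U q)"
    by blast
  show ?thesis
  proof (intro exI conjI)
    show "{n \<in> S. c n = q} \<subseteq> A"
      using S(1) by auto
    show "disjoint_family_on (\<lambda>n. sup_ball (x n) (r n)) {n \<in> S. c n = q}"
      using c(2) by (auto simp: disjoint_family_on_def)
  qed (use q in \<open>simp add: U_def Q_def\<close>)
qed

section \<open>Covering families of indices\<close>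

lemma (in finite_measure) measure_UN_finite_approx:
  fixes f :: "nat \<Rightarrow> 'a set"
  assumes f: "\<And>n. n \<in> I \<Longrightarrow> f n \<in> sets M" and c: "c < measure M (\<Union>n\<in>I. f n)"
  shows "\<exists>A. finite A \<and> A \<subseteq> I \<and> c < measure M (\<Union>n\<in>A. f n)"
proof -
  define U where "U k = (\<Union>n\<in>I \<inter> {..k}. f n)" for k
  have "range U \<subseteq> sets M"
    unfolding U_def using f by blast
  moreover have "incseq U"
    unfolding U_def by (intro monoI UN_mono) auto
  ultimately have "(\<lambda>k. measure M (U k)) \<longlonglongrightarrow> measure M (\<Union>k. U k)"
    by (rule finite_Lim_measure_incseq)
  moreover have "(\<Union>k. U k) = (\<Union>n\<in>I. f n)"
    by (auto simp: U_def)
  ultimately have "eventually (\<lambda>k. c < measure M (U k)) sequentially"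
    using c by (simp add: order_tendstoD)
  then obtain k where "c < measure M (U k)"
    by (auto simp: eventually_sequentially)
  then show ?thesis
    by (intro exI[of _ "I \<inter> {..k}"]) (auto simp: U_def)
qed

text \<open>
  The covering property for the balls whose index lies in \<open>I\<close>, with the constant made explicit
  and with finite index sets in place of nondecreasing finite sequences of indices.
\<close>

definition covering_family ::
    "'a::topological_space measure \<Rightarrow> (nat \<Rightarrow> 'a set) \<Rightarrow> real \<Rightarrow> nat set \<Rightarrow> bool" where
  "covering_family M B C I \<longleftrightarrow>
     (\<forall>U g. open U \<longrightarrow> (\<exists>T. finite T \<and> T \<subseteq> I \<inter> {g..} \<and> (\<forall>n\<in>T. B n \<subseteq> U) \<and>
        disjoint_family_on B T \<and> C * measure M U \<le> measure M (\<Union>n\<in>T. B n)))"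

lemma covering_familyE:
  assumes "covering_family M B C I" "open U"
  obtains T where "finite T" "T \<subseteq> I \<inter> {g..}" "\<And>n. n \<in> T \<Longrightarrow> B n \<subseteq> U"
    "disjoint_family_on B T" "C * measure M U \<le> measure M (\<Union>n\<in>T. B n)"
proof -
  have "\<exists>T. finite T \<and> T \<subseteq> I \<inter> {g..} \<and> (\<forall>n\<in>T. B n \<subseteq> U) \<and> disjoint_family_on B T \<and>
      C * measure M U \<le> measure M (\<Union>n\<in>T. B n)"
    using assms unfolding covering_family_def by simp
  then show ?thesis
    using that by (elim exE conjE) blast
qed

lemma asymptotically_covering_iff:
  "asymptotically_covering M x r \<longleftrightarrow>
     (\<exists>C>0. covering_family M (\<lambda>n. sup_ball (x n) (r n)) C UNIV)"
proof -
  have "(\<exists>N. \<exists>n::nat \<Rightarrow> nat. (\<forall>i\<in>{1..N}. g \<le> n i) \<and> mono_on {1..N} n \<and>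
       (\<forall>i\<in>{1..N}. sup_ball (x (n i)) (r (n i)) \<subseteq> U) \<and>
       (\<forall>i\<in>{1..N}. \<forall>j\<in>{1..N}. i \<noteq> j \<longrightarrow>
          sup_ball (x (n i)) (r (n i)) \<inter> sup_ball (x (n j)) (r (n j)) = {}) \<and>
       c \<le> measure M (\<Union>i\<in>{1..N}. sup_ball (x (n i)) (r (n i)))) \<longleftrightarrow>
    (\<exists>T. finite T \<and> T \<subseteq> UNIV \<inter> {g..} \<and> (\<forall>n\<in>T. sup_ball (x n) (r n) \<subseteq> U) \<and>
       disjoint_family_on (\<lambda>n. sup_ball (x n) (r n)) T \<and>
       c \<le> measure M (\<Union>n\<in>T. sup_ball (x n) (r n)))" (is "?L \<longleftrightarrow> ?R") for g U c
  proof
    assume ?L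
    then obtain N and n :: "nat \<Rightarrow> nat" where n: "\<forall>i\<in>{1..N}. g \<le> n i"
        "\<forall>i\<in>{1..N}. sup_ball (x (n i)) (r (n i)) \<subseteq> U"
        "\<forall>i\<in>{1..N}. \<forall>j\<in>{1..N}. i \<noteq> j \<longrightarrow>
          sup_ball (x (n i)) (r (n i)) \<inter> sup_ball (x (n j)) (r (n j)) = {}"
        "c \<le> measure M (\<Union>i\<in>{1..N}. sup_ball (x (n i)) (r (n i)))"
      by (elim exE conjE) blast
    have "disjoint_family_on (\<lambda>n. sup_ball (x n) (r n)) (n ` {1..N})"
      unfolding disjoint_family_on_def
    proof (intro ballI impI)
      fix a b assume "a \<in> n ` {1..N}" "b \<in> n ` {1..N}" "a \<noteq> b"
      then obtain i j where "i \<in> {1..N}" "j \<in> {1..N}" "i \<noteq> j" "a = n i" "b = n j"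
        by blast
      then show "sup_ball (x a) (r a) \<inter> sup_ball (x b) (r b) = {}"
        using n(3) by blast
    qed
    then show ?R
      using n by (intro exI[of _ "n ` {1..N}"]) auto
  next
    assume ?R
    then obtain T where T: "finite T" "T \<subseteq> {g..}" "\<forall>n\<in>T. sup_ball (x n) (r n) \<subseteq> U"
        "disjoint_family_on (\<lambda>n. sup_ball (x n) (r n)) T"
        "c \<le> measure M (\<Union>n\<in>T. sup_ball (x n) (r n))"
      by auto
    obtain h where h: "bij_betw h {..<card T} T" "strict_mono_on {..<card T} h"
      using ex_bij_betw_strict_mono_card[OF T(1)] by blast
    define n where "n i = h (i - 1)" for i :: nat
    have pred: "i - 1 \<in> {..<card T}" if "i \<in> {1..card T}" for i
      using that by auto
    have n_in: "n i \<in> T" if "i \<in> {1..card T}" for i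
      unfolding n_def using h(1) pred[OF that] bij_betwE by blast
    have n_inj: "n i \<noteq> n j" if "i \<in> {1..card T}" "j \<in> {1..card T}" "i \<noteq> j" for i j
      using inj_onD[OF bij_betw_imp_inj_on[OF h(1)] _ pred[OF that(1)] pred[OF that(2)]] that
      by (auto simp: n_def)
    have "{..<card T} = (\<lambda>i. i - 1) ` {1..card T}"
      by (auto intro!: image_eqI[of _ _ "Suc i" for i])
    then have image: "n ` {1..card T} = T"
      using bij_betw_imp_surj_on[OF h(1)] by (simp add: n_def image_image)
    have "mono_on {1..card T} n"
    proof (rule mono_onI)
      fix i j assume ij: "i \<in> {1..card T}" "j \<in> {1..card T}" "i \<le> j"
      then show "n i \<le> n j"
        unfolding n_def using strict_mono_on_leD[OF h(2) pred pred] by auto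
    qed
    moreover have "(\<Union>i\<in>{1..card T}. sup_ball (x (n i)) (r (n i))) = (\<Union>n\<in>T. sup_ball (x n) (r n))"
      using arg_cong[OF image, of "\<lambda>S. \<Union>n\<in>S. sup_ball (x n) (r n)"] by simp
    ultimately show ?L
      using T(5) disjoint_family_onD[OF T(4) n_in n_in n_inj] n_in T(3)
        subsetD[OF T(2) n_in]
      by (intro exI[of _ "card T"] exI[of _ n] conjI ballI impI) simp_all
  qed
  then show ?thesis
    unfolding asymptotically_covering_def covering_family_def by simp
qed

lemma covering_family_infinite:
  assumes "covering_family M B C I" "0 < C" "0 < measure M UNIV"
  shows "infinite I"
proof
  assume "finite I"
  then obtain g where "I \<subseteq> {..<g}"
    using finite_nat_bounded by blast
  moreover obtain T where T: "T \<subseteq> I \<inter> {g..}" "C * measure M UNIV \<le> measure M (\<Union>n\<in>T. B n)"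
    using covering_familyE[OF assms(1) open_UNIV] by metis
  ultimately have "T = {}"
    by fastforce
  then show False
    using T(2) assms(2,3) by (simp add: zero_less_mult_iff mult_le_0_iff)
qed

lemma covering_family_enumerate:
  assumes I: "covering_family M B C I" "infinite I"
  shows "covering_family M (B \<circ> enumerate I) C UNIV"
  unfolding covering_family_def
proof (intro allI impI)
  fix U :: "'a set" and g :: nat
  assume "open U"
  then obtain T where T: "finite T" "T \<subseteq> I \<inter> {enumerate I g..}" "\<And>n. n \<in> T \<Longrightarrow> B n \<subseteq> U"
      "disjoint_family_on B T" "C * measure M U \<le> measure M (\<Union>n\<in>T. B n)"
    using covering_familyE[OF I(1), of U "enumerate I g"] by blast
  let ?T = "enumerate I -` T"
  have inj: "inj (enumerate I)"
    using strict_mono_enumerate[OF I(2)] strict_mono_imp_inj_on by blast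
  have "T \<subseteq> range (enumerate I)"
    using T(2) range_enumerate[OF I(2)] by blast
  then have image: "enumerate I ` ?T = T"
    by (auto simp: image_vimage_eq)
  show "\<exists>T. finite T \<and> T \<subseteq> UNIV \<inter> {g..} \<and> (\<forall>n\<in>T. (B \<circ> enumerate I) n \<subseteq> U) \<and>
      disjoint_family_on (B \<circ> enumerate I) T \<and>
      C * measure M U \<le> measure M (\<Union>n\<in>T. (B \<circ> enumerate I) n)"
  proof (intro exI[of _ ?T] conjI)
    show "finite ?T"
      using T(1) inj by (rule finite_vimageI)
    show "?T \<subseteq> UNIV \<inter> {g..}"
      using T(2) strict_mono_less_eq[OF strict_mono_enumerate[OF I(2)]] by auto
    show "\<forall>n\<in>?T. (B \<circ> enumerate I) n \<subseteq> U"
      using T(3) by auto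
    show "disjoint_family_on (B \<circ> enumerate I) ?T"
      using T(4) inj by (auto simp: disjoint_family_on_def inj_def)
    have "(\<Union>n\<in>?T. (B \<circ> enumerate I) n) = (\<Union>n\<in>enumerate I ` ?T. B n)"
      by auto
    then show "C * measure M U \<le> measure M (\<Union>n\<in>?T. (B \<circ> enumerate I) n)"
      using T(5) image by simp
  qed
qed

lemma covering_family_if_limsup_full:
  fixes M :: "(real ^ 'd) measure"
  assumes M: "finite_measure M" "sets M = sets borel"
    and v: "0 \<le> v" "v < 1" and r: "\<And>n. 0 < r n" "r \<longlonglongrightarrow> 0"
    and full: "AE z in M. \<forall>g. \<exists>n\<ge>g. n \<in> I \<and> z \<in> sup_ball (x n) (v * r n)"
  shows "covering_family M (\<lambda>n. sup_ball (x n) (r n))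
    (1 / (2 * real (colour_number v CARD('d)))) I"
  unfolding covering_family_def
proof (intro allI impI)
  interpret finite_measure M by (rule M)
  have meas [measurable]: "sup_ball p s \<in> sets M" for p s
    unfolding M(2) by (rule borel_closed[OF closed_sup_ball])
  define Q where "Q = real (colour_number v CARD('d))"
  have Q: "0 < Q"
    by (simp add: Q_def colour_number_def del: of_nat_Suc)
  fix U :: "(real ^ 'd) set" and g :: nat
  assume U: "open U"
  show "\<exists>T. finite T \<and> T \<subseteq> I \<inter> {g..} \<and> (\<forall>n\<in>T. sup_ball (x n) (r n) \<subseteq> U) \<and>
      disjoint_family_on (\<lambda>n. sup_ball (x n) (r n)) T \<and>
      1 / (2 * real (colour_number v CARD('d))) * measure M U
        \<le> measure M (\<Union>n\<in>T. sup_ball (x n) (r n))"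
  proof (cases "measure M U = 0")
    case True
    then show ?thesis
      by (intro exI[of _ "{}"]) (simp add: disjoint_family_on_def)
  next
    case False
    define I' where "I' = {n \<in> I. g \<le> n \<and> sup_ball (x n) (r n) \<subseteq> U}"
    have "measure M U \<le> measure M (\<Union>n\<in>I'. sup_ball (x n) (v * r n))"
    proof (rule finite_measure_mono_AE)
      show "AE z in M. z \<in> U \<longrightarrow> z \<in> (\<Union>n\<in>I'. sup_ball (x n) (v * r n))"
        using full
      proof eventually_elim
        case (elim z)
        show ?case
        proof
          assume "z \<in> U"
          then obtain e where e: "0 < e" "sup_ball z e \<subseteq> U"
            using open_contains_sup_ball[OF U] by blast
          have "eventually (\<lambda>n. r n < e / 2) sequentially"
            using r(2) e(1) by (intro order_tendstoD) auto
          then obtain h where h: "\<And>n. h \<le> n \<Longrightarrow> r n < e / 2"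
            by (auto simp: eventually_sequentially)
          obtain n where n: "max g h \<le> n" "n \<in> I" "z \<in> sup_ball (x n) (v * r n)"
            using elim by blast
          have "v * r n \<le> 1 * r n"
            using v r(1)[of n] by (intro mult_right_mono) auto
          then have "z \<in> sup_ball (x n) (r n)"
            using n(3) sup_ball_mono[of "v * r n" "r n" "x n"] by auto
          then have "x n \<in> sup_ball z (r n)"
            by (simp add: mem_sup_ball abs_minus_commute)
          then have "sup_ball (x n) (r n) \<subseteq> sup_ball z e"
            using h[of n] n(1) by (intro sup_ball_subset_sup_ball[where t = "r n"]) auto
          then have "n \<in> I'"
            using n e by (auto simp: I'_def)
          then show "z \<in> (\<Union>n\<in>I'. sup_ball (x n) (v * r n))"
            using n by blast
        qed
      qed
    qed auto
    moreover have "0 < measure M U"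
      using False measure_nonneg[of M U] by linarith
    ultimately have "measure M U / 2 < measure M (\<Union>n\<in>I'. sup_ball (x n) (v * r n))"
      by linarith
    from measure_UN_finite_approx[OF meas this]
    obtain A where A: "finite A" "A \<subseteq> I'"
        "measure M U / 2 < measure M (\<Union>n\<in>A. sup_ball (x n) (v * r n))"
      by (elim exE conjE) (rule that)
    obtain T where T: "T \<subseteq> A" "disjoint_family_on (\<lambda>n. sup_ball (x n) (r n)) T"
        "measure M (\<Union>n\<in>A. sup_ball (x n) (v * r n))
          \<le> Q * measure M (\<Union>n\<in>T. sup_ball (x n) (r n))"
      using disjoint_subfamily_large_measure[where x = x and r = r, OF M v r(1) A(1),
        folded Q_def] by (elim exE conjE) (rule that)
    have "measure M U / 2 \<le> Q * measure M (\<Union>n\<in>T. sup_ball (x n) (r n))"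
      using A(3) T(3) by linarith
    then have "1 / (2 * Q) * measure M U \<le> measure M (\<Union>n\<in>T. sup_ball (x n) (r n))"
      using Q by (simp add: field_simps)
    then have large: "1 / (2 * real (colour_number v CARD('d))) * measure M U
        \<le> measure M (\<Union>n\<in>T. sup_ball (x n) (r n))"
      by (simp only: Q_def)
    have "finite T" "T \<subseteq> I'"
      using T(1) A(1,2) finite_subset by blast+
    moreover from this have "T \<subseteq> I \<inter> {g..}" "\<forall>n\<in>T. sup_ball (x n) (r n) \<subseteq> U"
      by (auto simp: I'_def)
    ultimately show ?thesis
      using T(2) large by (intro exI[of _ T] conjI)
  qed
qed

section \<open>Sparse subfamilies\<close>

lemma open_sets_countable_inner_approximation:
  fixes M :: "'a::second_countable_topology measure"
  assumes "finite_measure M" "sets M = sets borel"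
  obtains V :: "nat \<Rightarrow> 'a set" where "\<And>i. open (V i)"
    "\<And>U c. open U \<Longrightarrow> c < measure M U \<Longrightarrow> \<exists>i. V i \<subseteq> U \<and> c < measure M (V i)"
proof -
  interpret finite_measure M by (rule assms)
  obtain \<B> :: "'a set set" where \<B>: "countable \<B>" "topological_basis \<B>"
    using ex_countable_basis by blast
  have "\<B> \<noteq> {}"
    using topological_basisE[OF \<B>(2) open_UNIV UNIV_I] by blast
  define b where "b = from_nat_into \<B>"
  have b: "range b = \<B>"
    unfolding b_def using \<B>(1) \<open>\<B> \<noteq> {}\<close> by (rule range_from_nat_into[rotated])
  have open_b: "open (b n)" for n
    using topological_basis_open[OF \<B>(2)] b by blast
  show ?thesis
  proof (rule that[of "\<lambda>i. \<Union>n\<in>set_decode i. b n"])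
    show "open (\<Union>n\<in>set_decode i. b n)" for i
      using open_b by blast
    fix U :: "'a set" and c
    assume U: "open U" "c < measure M U"
    have "U = (\<Union>n\<in>{n. b n \<subseteq> U}. b n)"
    proof
      show "U \<subseteq> (\<Union>n\<in>{n. b n \<subseteq> U}. b n)"
      proof
        fix z assume "z \<in> U"
        then obtain W where "W \<in> \<B>" "z \<in> W" "W \<subseteq> U"
          using topological_basisE[OF \<B>(2) U(1)] by metis
        then show "z \<in> (\<Union>n\<in>{n. b n \<subseteq> U}. b n)"
          using b by blast
      qed
    qed auto
    then obtain A where A: "finite A" "A \<subseteq> {n. b n \<subseteq> U}" "c < measure M (\<Union>n\<in>A. b n)"
      using measure_UN_finite_approx[of "{n. b n \<subseteq> U}" b c] U(2) open_b assms(2) by auto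
    then show "\<exists>i. (\<Union>n\<in>set_decode i. b n) \<subseteq> U \<and> c < measure M (\<Union>n\<in>set_decode i. b n)"
      by (intro exI[of _ "set_encode A"]) auto
  qed
qed

text \<open>
  The diagonal construction. Stage \<open>p\<close> uses indices in \<open>G p\<close> only and consists of \<open>p + 1\<close> finite
  disjoint families, one for each of the first open sets of a countable approximating sequence.
  The radii of a stage are less than half of all the radii of the earlier stages.
\<close>

lemma sparse_covering_family:
  fixes M :: "'a::second_countable_topology measure" and r :: "nat \<Rightarrow> real"
  assumes M: "finite_measure M" "sets M = sets borel"
    and G: "\<And>p. covering_family M B C (G p)" and C: "0 \<le> C"
    and r: "\<And>n. 0 < r n" "r \<longlonglongrightarrow> 0"
  obtains F :: "nat \<Rightarrow> nat \<Rightarrow> nat set" where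
    "\<And>p i. finite (F p i)" "\<And>p i. F p i \<subseteq> G p" "\<And>p i. disjoint_family_on B (F p i)"
    "\<And>p i n. n \<in> F p i \<Longrightarrow> r n < 2 powr (- real p)"
    "\<And>p q i j m n. p < q \<Longrightarrow> i \<le> p \<Longrightarrow> m \<in> F p i \<Longrightarrow> n \<in> F q j \<Longrightarrow> 2 * r n < r m"
    "covering_family M B (C / 2) (\<Union>p. \<Union>i\<le>p. F p i)"
proof -
  obtain V :: "nat \<Rightarrow> 'a set" where V: "\<And>i. open (V i)"
      "\<And>U c. open U \<Longrightarrow> c < measure M U \<Longrightarrow> \<exists>i. V i \<subseteq> U \<and> c < measure M (V i)"
    using open_sets_countable_inner_approximation[OF M] by blast
  define stage where "stage p g i T \<longleftrightarrow> finite T \<and> T \<subseteq> G p \<inter> {g..} \<and> (\<forall>n\<in>T. B n \<subseteq> V i) \<and>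
      disjoint_family_on B T \<and> C * measure M (V i) \<le> measure M (\<Union>n\<in>T. B n)" for p g i T
  have "\<exists>T. stage p g i T" for p g i
    using covering_familyE[OF G[of p] V(1)[of i], of g] unfolding stage_def by metis
  then obtain E where stage: "\<And>p g i. stage p g i (E p g i)"
    by metis
  then have finite_E: "finite (E p g i)" for p g i
    unfolding stage_def by blast
  define later where "later p g h \<longleftrightarrow> g < h \<and> (\<forall>n\<ge>h. r n < 2 powr (- real (Suc p)) \<and>
      (\<forall>m\<in>(\<Union>i\<le>p. E p g i). 2 * r n < r m))" for p g h
  have "\<exists>h. later p g h" for p g
  proof -
    have small: "eventually (\<lambda>n. r n < c) sequentially" if "0 < c" for c
      using order_tendstoD(2)[OF r(2) that] .
    have "eventually (\<lambda>n. \<forall>m\<in>(\<Union>i\<le>p. E p g i). r n < r m / 2) sequentially"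
      using finite_E r(1) by (intro eventually_ball_finite ballI small) auto
    then have "eventually (\<lambda>n. g < n \<and> r n < 2 powr (- real (Suc p)) \<and>
        (\<forall>m\<in>(\<Union>i\<le>p. E p g i). r n < r m / 2)) sequentially"
      by (intro eventually_conj eventually_gt_at_top small) auto
    then obtain h where h: "\<And>n. h \<le> n \<Longrightarrow> g < n \<and> r n < 2 powr (- real (Suc p)) \<and>
        (\<forall>m\<in>(\<Union>i\<le>p. E p g i). r n < r m / 2)"
      by (auto simp: eventually_sequentially)
    show ?thesis
      unfolding later_def
    proof (intro exI[of _ h] conjI allI impI ballI)
      show "g < h"
        using h[of h] by blast
      show "r n < 2 powr (- real (Suc p))" if "h \<le> n" for n
        using h[OF that] by blast
      show "2 * r n < r m" if "h \<le> n" "m \<in> (\<Union>i\<le>p. E p g i)" for n m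
      proof -
        have "r n < r m / 2"
          using h[OF that(1)] that(2) by blast
        then show ?thesis by simp
      qed
    qed
  qed
  then obtain H where later: "\<And>p g. later p g (H p g)"
    by metis
  then have H: "g < H p g" "\<And>n. H p g \<le> n \<Longrightarrow> r n < 2 powr (- real (Suc p))"
      "\<And>n m. H p g \<le> n \<Longrightarrow> m \<in> (\<Union>i\<le>p. E p g i) \<Longrightarrow> 2 * r n < r m" for p g
    unfolding later_def by blast+
  have "eventually (\<lambda>n. r n < 1) sequentially"
    using r(2) by (rule order_tendstoD) simp
  then obtain g0 where g0: "\<And>n. g0 \<le> n \<Longrightarrow> r n < 1"
    by (auto simp: eventually_sequentially)
  define start where "start = rec_nat g0 H"
  have start: "start 0 = g0" "start (Suc p) = H p (start p)" for p
    by (simp_all add: start_def)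
  have mono: "strict_mono start"
    using H(1) by (simp add: strict_mono_Suc_iff start)
  define F where "F p i = E p (start p) i" for p i
  have F: "finite (F p i)" "F p i \<subseteq> G p" "disjoint_family_on B (F p i)" "F p i \<subseteq> {start p..}"
      "\<And>n. n \<in> F p i \<Longrightarrow> B n \<subseteq> V i" "C * measure M (V i) \<le> measure M (\<Union>n\<in>F p i. B n)" for p i
    using stage[of p "start p" i] unfolding stage_def F_def by blast+
  show ?thesis
  proof (rule that[of F])
    fix p q i j m n
    show "r n < 2 powr (- real p)" if "n \<in> F p i"
    proof (cases p)
      case 0
      then show ?thesis
        using that F(4)[of p i] g0[of n] start(1) by auto
    next
      case (Suc p')
      then show ?thesis
        using that F(4)[of p i] H(2)[of p' "start p'" n] start(2) by auto
    qed
    show "2 * r n < r m" if "p < q" "i \<le> p" "m \<in> F p i" "n \<in> F q j"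
    proof (rule H(3))
      have "start (Suc p) \<le> start q"
        using that(1) mono by (simp add: strict_mono_less_eq)
      then show "H p (start p) \<le> n"
        using F(4)[of q j] that(4) start(2)[of p] by auto
      show "m \<in> (\<Union>i\<le>p. E p (start p) i)"
        using that by (auto simp: F_def)
    qed
  next
    show "covering_family M B (C / 2) (\<Union>p. \<Union>i\<le>p. F p i)"
      unfolding covering_family_def
    proof (intro allI impI)
      fix U :: "'a set" and g :: nat
      assume U: "open U"
      show "\<exists>T. finite T \<and> T \<subseteq> (\<Union>p. \<Union>i\<le>p. F p i) \<inter> {g..} \<and> (\<forall>n\<in>T. B n \<subseteq> U) \<and>
          disjoint_family_on B T \<and> C / 2 * measure M U \<le> measure M (\<Union>n\<in>T. B n)"
      proof (cases "measure M U = 0")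
        case True
        then show ?thesis
          by (intro exI[of _ "{}"]) (simp add: disjoint_family_on_def)
      next
        case False
        then have "measure M U / 2 < measure M U"
          using measure_nonneg[of M U] by linarith
        then obtain i where i: "V i \<subseteq> U" "measure M U / 2 < measure M (V i)"
          using V(2)[OF U] by blast
        \<comment> \<open>Stage \<open>p\<close> treats \<open>V i\<close> if \<open>i \<le> p\<close>, and its indices are at least \<open>start p \<ge> p\<close>.\<close>
        define p where "p = max i g"
        have "g \<le> start p"
          using strict_mono_imp_increasing[OF mono, of p] by (simp add: p_def)
        have "C / 2 * measure M U \<le> C * measure M (V i)"
          using mult_left_mono[OF less_imp_le[OF i(2)] C] by simp
        also have "\<dots> \<le> measure M (\<Union>n\<in>F p i. B n)"
          by (rule F(6))
        finally have large: "C / 2 * measure M U \<le> measure M (\<Union>n\<in>F p i. B n)" .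
        have "i \<le> p"
          by (simp add: p_def)
        show ?thesis
        proof (intro exI[of _ "F p i"] conjI)
          show "F p i \<subseteq> (\<Union>p. \<Union>i\<le>p. F p i) \<inter> {g..}"
            using F(4)[of p i] \<open>i \<le> p\<close> \<open>g \<le> start p\<close> by fastforce
          show "\<forall>n\<in>F p i. B n \<subseteq> U"
            using F(5) i(1) by blast
        qed (use F large in auto)
      qed
    qed
  qed (use F in auto)
qed

section \<open>Local dimensions and measures of balls\<close>

lemma log_ratio_eq:
  assumes "0 < s" "s < 1"
  shows "log_ratio m s = (if m = 0 then \<infinity> else ereal (ln m / ln s))"
proof -
  have "ln s < 0"
    using assms by simp
  then show ?thesis
    using assms by (auto simp: log_ratio_def log_ereal_def divide_ereal_def divide_inverse)
qed

lemma log_ratio_antimono: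
  assumes "0 < s" "s < 1" "0 \<le> m" "m \<le> m'"
  shows "log_ratio m' s \<le> log_ratio m s"
proof -
  have "ln m' / ln s \<le> ln m / ln s" if "0 < m"
    using assms that by (intro divide_right_mono_neg) auto
  then show ?thesis
    using assms by (auto simp: log_ratio_eq)
qed

lemma filterlim_scaled_at_right_0:
  fixes r :: "nat \<Rightarrow> real"
  assumes "0 < c" "\<And>n. 0 < r n" "r \<longlonglongrightarrow> 0"
  shows "filterlim (\<lambda>n. c * r n) (at_right 0) sequentially"
proof (rule tendsto_imp_filterlim_at_right)
  show "(\<lambda>n. c * r n) \<longlonglongrightarrow> 0"
    using tendsto_mult_left[OF assms(3), of c] by simp
  show "\<forall>\<^sub>F n in sequentially. 0 < c * r n"
    using assms by (intro always_eventually) simp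
qed

text \<open>
  If \<open>z\<close> lies in the contraction of the ball with centre \<open>x n\<close>, then that ball lies between
  the balls around \<open>z\<close> with radii \<open>(1 - v) * r n\<close> and \<open>2 * r n\<close>. The radius of the
  larger one is the diameter of the ball in the middle, so that the lower bound is exact; the
  radius of the smaller one is off by a constant factor, which is negligible on the logarithmic
  scale.
\<close>

lemma AE_log_ratio_ge:
  fixes M :: "(real ^ 'd) measure"
  assumes M: "finite_measure M" "sets M = sets borel"
    and v: "0 \<le> v" "v < 1" and r: "\<And>n. 0 < r n" "r \<longlonglongrightarrow> 0"
    and a: "a < lower_dim_H M"
  shows "AE z in M. eventually (\<lambda>n. z \<in> sup_ball (x n) (v * r n) \<longrightarrow>
    a \<le> log_ratio (measure M (sup_ball (x n) (r n))) (2 * r n)) sequentially"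
proof -
  interpret finite_measure M by (rule M)
  have meas: "sup_ball p s \<in> sets M" for p s
    unfolding M(2) by (rule borel_closed[OF closed_sup_ball])
  have scale: "filterlim (\<lambda>n. 2 * r n) (at_right 0) sequentially"
    using r by (intro filterlim_scaled_at_right_0) auto
  have "AE z in M. a < lower_local_dim M z"
    using a unfolding lower_dim_H_def by (rule less_LiminfD)
  then show ?thesis
  proof eventually_elim
    case (elim z)
    then have "eventually (\<lambda>s. a < log_ratio (measure M (sup_ball z s)) s) (at_right 0)"
      unfolding lower_local_dim_def by (rule less_LiminfD)
    then have "eventually (\<lambda>n. a < log_ratio (measure M (sup_ball z (2 * r n))) (2 * r n))
        sequentially"
      using scale by (rule eventually_compose_filterlim)
    moreover have "eventually (\<lambda>n. r n < 1 / 2) sequentially"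
      using r(2) by (rule order_tendstoD) simp
    ultimately show ?case
    proof eventually_elim
      case (elim n)
      show ?case
      proof
        assume z: "z \<in> sup_ball (x n) (v * r n)"
        have "v * r n \<le> 1 * r n"
          using v r(1)[of n] by (intro mult_right_mono) auto
        moreover have "x n \<in> sup_ball z (v * r n)"
          using z by (simp add: mem_sup_ball abs_minus_commute)
        ultimately have "sup_ball (x n) (r n) \<subseteq> sup_ball z (2 * r n)"
          by (intro sup_ball_subset_sup_ball) auto
        then have "measure M (sup_ball (x n) (r n)) \<le> measure M (sup_ball z (2 * r n))"
          using meas by (intro finite_measure_mono) auto
        then have "log_ratio (measure M (sup_ball z (2 * r n))) (2 * r n)
            \<le> log_ratio (measure M (sup_ball (x n) (r n))) (2 * r n)"
          using r(1)[of n] elim by (intro log_ratio_antimono) auto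
        then show "a \<le> log_ratio (measure M (sup_ball (x n) (r n))) (2 * r n)"
          using elim by order
      qed
    qed
  qed
qed

lemma AE_log_ratio_le:
  fixes M :: "(real ^ 'd) measure"
  assumes M: "finite_measure M" "sets M = sets borel"
    and v: "0 \<le> v" "v < 1" and r: "\<And>n. 0 < r n" "r \<longlonglongrightarrow> 0"
    and b: "upper_dim_P M < b"
  shows "AE z in M. eventually (\<lambda>n. z \<in> sup_ball (x n) (v * r n) \<longrightarrow>
    log_ratio (measure M (sup_ball (x n) (r n))) (2 * r n) \<le> b) sequentially"
proof -
  interpret finite_measure M by (rule M)
  have meas: "sup_ball p s \<in> sets M" for p s
    unfolding M(2) by (rule borel_closed[OF closed_sup_ball])
  \<comment> \<open>The gap between \<open>b1\<close> and \<open>b2\<close> absorbs the change of scale.\<close>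
  obtain b2 where b2: "upper_dim_P M < ereal b2" "ereal b2 < b"
    using ereal_dense2[OF b] by blast
  obtain b1 where b1: "upper_dim_P M < ereal b1" "ereal b1 < ereal b2"
    using ereal_dense2[OF b2(1)] by blast
  define c where "c = 1 - v"
  have c: "0 < c" "c \<le> 1"
    using v by (auto simp: c_def)
  have lim_r: "filterlim r (at_right 0) sequentially"
    using filterlim_scaled_at_right_0[of 1 r] r by simp
  have scale: "filterlim (\<lambda>n. c * r n) (at_right 0) sequentially"
    using c(1) r by (rule filterlim_scaled_at_right_0)
  have "((\<lambda>s. b1 * (ln (c * s) / ln (2 * s))) \<longlongrightarrow> b1) (at_right 0)"
    using c(1) by real_asymp
  from filterlim_compose[OF this lim_r]
  have "eventually (\<lambda>n. b1 * (ln (c * r n) / ln (2 * r n)) < b2) sequentially"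
    using b1(2) by (intro order_tendstoD) auto
  moreover have "eventually (\<lambda>n. r n < 1 / 2) sequentially"
    using r(2) by (rule order_tendstoD) simp
  ultimately have ev: "eventually (\<lambda>n. b1 * (ln (c * r n) / ln (2 * r n)) < b2 \<and> r n < 1 / 2)
      sequentially"
    by (rule eventually_conj)
  have "AE z in M. upper_local_dim M z < ereal b1"
    using b1(1) unfolding upper_dim_P_def by (rule Limsup_lessD)
  then show ?thesis
  proof eventually_elim
    case (elim z)
    then have "eventually (\<lambda>s. log_ratio (measure M (sup_ball z s)) s < ereal b1) (at_right 0)"
      unfolding upper_local_dim_def by (rule Limsup_lessD)
    then have "eventually (\<lambda>n. log_ratio (measure M (sup_ball z (c * r n))) (c * r n) < ereal b1)
        sequentially"
      using scale by (rule eventually_compose_filterlim)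
    from this ev show ?case
    proof eventually_elim
      case (elim n)
      show ?case
      proof
        assume z: "z \<in> sup_ball (x n) (v * r n)"
        define m where "m = measure M (sup_ball z (c * r n))"
        define s where "s = c * r n"
        define t where "t = 2 * r n"
        have t: "0 < t" "t < 1"
          using elim r(1)[of n] by (auto simp: t_def)
        have "c * r n \<le> 1 * r n"
          using c r(1)[of n] by (intro mult_right_mono) auto
        then have s: "0 < s" "s < 1"
          using elim r(1)[of n] c(1) unfolding s_def by (simp, linarith)
        have "m \<noteq> 0 \<and> ln m / ln s < b1"
          using elim log_ratio_eq[OF s, of m] by (auto simp: m_def s_def split: if_splits)
        then have m: "0 < m" "ln m / ln s \<le> b1"
          by (auto simp: m_def zero_less_measure_iff)
        have ln: "ln s < 0" "ln t < 0"
          using s t by auto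
        have "ln m / ln t = ln m / ln s * (ln s / ln t)"
          using ln by simp
        also have "\<dots> \<le> b1 * (ln s / ln t)"
          using m(2) ln by (intro mult_right_mono) (auto simp: divide_nonpos_nonpos)
        also have "\<dots> < b2"
          using elim by (simp add: s_def t_def)
        finally have "log_ratio m t < ereal b2"
          using m(1) by (simp add: log_ratio_eq[OF t])
        with b2(2) have "log_ratio m t < b"
          by order
        have "sup_ball z (c * r n) \<subseteq> sup_ball (x n) (r n)"
          using z by (rule sup_ball_subset_sup_ball) (simp add: c_def algebra_simps)
        then have "m \<le> measure M (sup_ball (x n) (r n))"
          unfolding m_def using meas by (intro finite_measure_mono) auto
        then have "log_ratio (measure M (sup_ball (x n) (r n))) t \<le> log_ratio m t"
          using t m(1) by (intro log_ratio_antimono) auto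
        with \<open>log_ratio m t < b\<close> show "log_ratio (measure M (sup_ball (x n) (r n))) (2 * r n) \<le> b"
          unfolding t_def by order
      qed
    qed
  qed
qed

text \<open>
  A monotone sequence approximating an extended real strictly from below. For minus infinity
  there is none, and the constant sequence serves instead.
\<close>

lemma ereal_incseq_approximation:
  fixes D :: ereal
  obtains a where "incseq a" "\<And>p::nat. a p = - \<infinity> \<or> a p < D" "a \<longlonglongrightarrow> D"
proof (cases "D = - \<infinity>")
  case True
  then show ?thesis
    by (intro that[of "\<lambda>_. - \<infinity>"]) (auto simp: incseq_def)
next
  case False
  then show ?thesis
    using countable_approach[OF False] that by blast
qed

lemma ereal_decseq_approximation:
  fixes D :: ereal
  obtains b where "decseq b" "\<And>p::nat. b p = \<infinity> \<or> D < b p" "b \<longlonglongrightarrow> D"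
proof -
  obtain a where a: "incseq a" "\<And>p::nat. a p = - \<infinity> \<or> a p < - D" "a \<longlonglongrightarrow> - D"
    using ereal_incseq_approximation[of "- D"] by blast
  show ?thesis
  proof (rule that[of "\<lambda>p. - a p"])
    show "decseq (\<lambda>p. - a p)"
      using a(1) by (simp add: incseq_def decseq_def)
    show "- a p = \<infinity> \<or> D < - a p" for p
      using a(2)[of p] by (auto simp: ereal_less_uminus_reorder ereal_uminus_eq_reorder)
    show "(\<lambda>p. - a p) \<longlonglongrightarrow> D"
      using tendsto_uminus_ereal[OF a(3)] by simp
  qed
qed

section \<open>Extracting the subsequences\<close>

lemma asymptotically_covering_subsequence:
  fixes M :: "(real ^ 'd) measure"
  assumes "prob_space M" "sets M = sets borel" "0 < C"
    and I: "covering_family M (\<lambda>n. sup_ball (x n) (r n)) C I"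
  shows "infinite I" "asymptotically_covering M (x \<circ> enumerate I) (r \<circ> enumerate I)"
proof -
  interpret prob_space M by (rule assms)
  have "space M = UNIV"
    using sets_eq_imp_space_eq[OF assms(2)] by simp
  then have "0 < measure M UNIV"
    using prob_space by simp
  then show inf: "infinite I"
    using covering_family_infinite[OF I assms(3)] by blast
  show "asymptotically_covering M (x \<circ> enumerate I) (r \<circ> enumerate I)"
    unfolding asymptotically_covering_iff
    using covering_family_enumerate[OF I inf] assms(3) by (auto simp: o_def)
qed

text \<open>
  Balls of one dyadic scale all come from one stage \<open>p\<close>, and \<open>p \<le> k\<close> for scale \<open>k\<close>; hence
  the \<open>p + 1\<close> disjoint families of that stage give at most \<open>k + 1\<close> classes. A ball that is in
  several of them is assigned to the first one.
\<close>

lemma weakly_redundant_if_sparse: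
  fixes x :: "nat \<Rightarrow> real ^ 'd" and F :: "nat \<Rightarrow> nat \<Rightarrow> nat set"
  assumes disj: "\<And>p i. disjoint_family_on (\<lambda>n. sup_ball (x n) (r n)) (F p i)"
    and small: "\<And>p i n. n \<in> F p i \<Longrightarrow> r n < 2 powr (- real p)"
    and sparse: "\<And>p q i j m n. p < q \<Longrightarrow> i \<le> p \<Longrightarrow> m \<in> F p i \<Longrightarrow> n \<in> F q j \<Longrightarrow> 2 * r n < r m"
    and \<phi>: "range \<phi> = (\<Union>p. \<Union>i\<le>p. F p i)"
  shows "weakly_redundant (x \<circ> \<phi>) (r \<circ> \<phi>)"
proof -
  define B where "B n = sup_ball (x n) (r n)" for n
  define scale where "scale k n \<longleftrightarrow> 2 powr (- real k - 1) < r n \<and> r n \<le> 2 powr (- real k)" for k n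
  have powr: "2 powr (- real k) = 2 * 2 powr (- real k - 1)" for k
    by (simp add: powr_diff)
  have stage_unique: "p = q"
    if "i \<le> p" "i \<le> q" "m \<in> F p i" "n \<in> F q i" "scale k m" "scale k n" for i p q m n k
  proof -
    have le: "\<not> 2 * r b < r a" if "scale k a" "scale k b" for a b
      using that powr[of k] unfolding scale_def by linarith
    show ?thesis
      using sparse[of p q i m n i] sparse[of q p i n m i] le that by (meson linorder_neqE_nat)
  qed
  define A where "A k i = {B n | n p. i \<le> p \<and> n \<in> F p i \<and> scale k n}" for k i
  define T where "T k j = disjointed (A k) (j - 1)" for k j
  have disj_A: "D \<inter> D' = {}" if D: "D \<in> A k i" "D' \<in> A k i" "D \<noteq> D'" for D D' k i
  proof -
    obtain n p where n: "D = B n" "i \<le> p" "n \<in> F p i" "scale k n"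
      using D(1) unfolding A_def by blast
    obtain m q where m: "D' = B m" "i \<le> q" "m \<in> F q i" "scale k m"
      using D(2) unfolding A_def by blast
    have "p = q"
      using stage_unique n m by blast
    moreover have "n \<noteq> m"
      using D(3) n(1) m(1) by blast
    ultimately show ?thesis
      using disjoint_family_onD[OF disj[of p i], of n m] n m by (simp add: B_def)
  qed
  have union_A: "(\<Union>i\<in>{0..<Suc k}. A k i) = scale_class (x \<circ> \<phi>) (r \<circ> \<phi>) k" for k
  proof -
    have "scale_class (x \<circ> \<phi>) (r \<circ> \<phi>) k = {B n | n. n \<in> range \<phi> \<and> scale k n}"
      by (auto simp: scale_class_def B_def scale_def)
    also have "\<dots> = (\<Union>i\<in>{0..<Suc k}. A k i)"
    proof
      show "(\<Union>i\<in>{0..<Suc k}. A k i) \<subseteq> {B n | n. n \<in> range \<phi> \<and> scale k n}"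
        unfolding A_def \<phi> by blast
      show "{B n | n. n \<in> range \<phi> \<and> scale k n} \<subseteq> (\<Union>i\<in>{0..<Suc k}. A k i)"
      proof
        fix D assume "D \<in> {B n | n. n \<in> range \<phi> \<and> scale k n}"
        then obtain n p i where n: "D = B n" "scale k n" "i \<le> p" "n \<in> F p i"
          unfolding \<phi> by blast
        have "2 powr (- real k - 1) < 2 powr (- real p)"
          using small[OF n(4)] n(2) unfolding scale_def by linarith
        then have "p < Suc k"
          by simp
        then have "i \<in> {0..<Suc k}"
          using n(3) by simp
        moreover have "D \<in> A k i"
          unfolding A_def using n by blast
        ultimately show "D \<in> (\<Union>i\<in>{0..<Suc k}. A k i)"
          by blast
      qed
    qed
    finally show ?thesis by simp
  qed
  have union_T: "(\<Union>j\<in>{1..Suc k}. T k j) = scale_class (x \<circ> \<phi>) (r \<circ> \<phi>) k" for k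
  proof -
    have "{1..Suc k} = Suc ` {0..<Suc k}"
      by (metis image_Suc_atLeastLessThan One_nat_def atLeastLessThanSuc_atLeastAtMost)
    then have "(\<Union>j\<in>{1..Suc k}. T k j) = (\<Union>j\<in>Suc ` {0..<Suc k}. T k j)"
      by (rule arg_cong)
    also have "\<dots> = (\<Union>i\<in>{0..<Suc k}. disjointed (A k) i)"
      by (simp add: T_def image_image del: image_Suc_atLeastLessThan)
    finally show ?thesis
      using finite_UN_disjointed_eq[of "A k" "Suc k"] union_A[of k] by simp
  qed
  have disj_T: "disjoint_family_on (T k) {1..Suc k}" for k
    unfolding disjoint_family_on_def
  proof (intro ballI impI)
    fix i j assume "i \<in> {1..Suc k}" "j \<in> {1..Suc k}" "i \<noteq> j"
    then have "i - 1 \<noteq> j - 1"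
      by auto
    then show "T k i \<inter> T k j = {}"
      unfolding T_def by (rule disjoint_family_onD[OF disjoint_family_disjointed UNIV_I UNIV_I])
  qed
  have T_A: "T k j \<subseteq> A k (j - 1)" for k j
    unfolding T_def by (rule disjointed_subset)
  have disjoint_T: "\<forall>D\<in>T k j. \<forall>D'\<in>T k j. D \<noteq> D' \<longrightarrow> D \<inter> D' = {}" for k j
  proof (intro ballI impI)
    fix D D' assume "D \<in> T k j" "D' \<in> T k j" "D \<noteq> D'"
    then show "D \<inter> D' = {}"
      by (rule disj_A[OF subsetD[OF T_A] subsetD[OF T_A]])
  qed
  have limit: "(\<lambda>k. log 2 (real (Suc k)) / real k) \<longlonglongrightarrow> 0"
    by real_asymp
  show ?thesis
    unfolding weakly_redundant_def
  proof (rule exI[of _ Suc], rule exI[of _ T], rule conjI[OF allI limit], intro conjI)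
    fix k
    show "1 \<le> Suc k"
      by simp
    show "(\<Union>j\<in>{1..Suc k}. T k j) = scale_class (x \<circ> \<phi>) (r \<circ> \<phi>) k"
      by (rule union_T)
    show "disjoint_family_on (T k) {1..Suc k}"
      by (rule disj_T)
    show "\<forall>j\<in>{1..Suc k}. \<forall>D\<in>T k j. \<forall>D'\<in>T k j. D \<noteq> D' \<longrightarrow> D \<inter> D' = {}"
      using disjoint_T by (rule ballI)
  qed
qed

theorem covering_subsequence_weakly_redundant:
  fixes M :: "(real ^ 'd) measure"
  assumes M: "prob_space M" "sets M = sets borel" and r: "\<And>n. 0 < r n" "r \<longlonglongrightarrow> 0"
    and ac: "asymptotically_covering M x r"
  shows "\<exists>\<phi> :: nat \<Rightarrow> nat. strict_mono \<phi> \<and> asymptotically_covering M (x \<circ> \<phi>) (r \<circ> \<phi>) \<and>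
    weakly_redundant (x \<circ> \<phi>) (r \<circ> \<phi>)"
proof -
  interpret prob_space M by (rule M)
  obtain C where C: "0 < C" "covering_family M (\<lambda>n. sup_ball (x n) (r n)) C UNIV"
    using ac unfolding asymptotically_covering_iff by blast
  obtain F :: "nat \<Rightarrow> nat \<Rightarrow> nat set" where
    F: "\<And>p i. finite (F p i)" "\<And>p i. F p i \<subseteq> UNIV"
      "\<And>p i. disjoint_family_on (\<lambda>n. sup_ball (x n) (r n)) (F p i)"
      "\<And>p i n. n \<in> F p i \<Longrightarrow> r n < 2 powr (- real p)"
      "\<And>p q i j m n. p < q \<Longrightarrow> i \<le> p \<Longrightarrow> m \<in> F p i \<Longrightarrow> n \<in> F q j \<Longrightarrow> 2 * r n < r m"
    and cov: "covering_family M (\<lambda>n. sup_ball (x n) (r n)) (C / 2) (\<Union>p. \<Union>i\<le>p. F p i)"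
    by (rule sparse_covering_family[where G = "\<lambda>_. UNIV" and r = r,
        OF finite_measure_axioms M(2) C(2) less_imp_le[OF C(1)] r]) (rule that)
  let ?\<phi> = "enumerate (\<Union>p. \<Union>i\<le>p. F p i)"
  have inf: "infinite (\<Union>p. \<Union>i\<le>p. F p i)"
    and sub: "asymptotically_covering M (x \<circ> ?\<phi>) (r \<circ> ?\<phi>)"
    using asymptotically_covering_subsequence[OF M _ cov] C(1) by auto
  have "weakly_redundant (x \<circ> ?\<phi>) (r \<circ> ?\<phi>)"
    using F(3-5) range_enumerate[OF inf] by (rule weakly_redundant_if_sparse)
  with sub show ?thesis
    using strict_mono_enumerate[OF inf] by blast
qed

theorem covering_subsequence_dimension_bounds:
  fixes M :: "(real ^ 'd) measure"
  assumes M: "prob_space M" "sets M = sets borel" and r: "\<And>n. 0 < r n" "r \<longlonglongrightarrow> 0"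
    and v: "0 \<le> v" "v < 1"
    and full: "measure M (\<Inter>g. \<Union>n\<in>{g..}. sup_ball (x n) (v * r n)) = 1"
  defines "\<rho> \<equiv> \<lambda>n. log_ratio (measure M (sup_ball (x n) (r n))) (2 * r n)"
  shows "\<exists>\<phi> :: nat \<Rightarrow> nat. strict_mono \<phi> \<and> asymptotically_covering M (x \<circ> \<phi>) (r \<circ> \<phi>) \<and>
    lower_dim_H M \<le> liminf (\<lambda>n. \<rho> (\<phi> n)) \<and> limsup (\<lambda>n. \<rho> (\<phi> n)) \<le> upper_dim_P M"
proof -
  interpret prob_space M by (rule M)
  have meas: "sup_ball p s \<in> sets M" for p s
    unfolding M(2) by (rule borel_closed[OF closed_sup_ball])
  have limsup_AE: "AE z in M. \<forall>g. \<exists>n\<ge>g. z \<in> sup_ball (x n) (v * r n)"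
  proof -
    have "(\<Inter>g. \<Union>n\<in>{g..}. sup_ball (x n) (v * r n)) \<in> sets M"
      using meas by blast
    then have "AE z in M. z \<in> (\<Inter>g. \<Union>n\<in>{g..}. sup_ball (x n) (v * r n))"
      using full by (simp only: prob_eq_1)
    then show ?thesis
      by eventually_elim auto
  qed
  obtain a where a: "incseq a" "\<And>p::nat. a p = - \<infinity> \<or> a p < lower_dim_H M" "a \<longlonglongrightarrow> lower_dim_H M"
    using ereal_incseq_approximation[of "lower_dim_H M"] by blast
  obtain b where b: "decseq b" "\<And>p::nat. b p = \<infinity> \<or> upper_dim_P M < b p" "b \<longlonglongrightarrow> upper_dim_P M"
    using ereal_decseq_approximation[of "upper_dim_P M"] by blast
  define G where "G p = {n. a p \<le> \<rho> n \<and> \<rho> n \<le> b p}" for p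
  define C where "C = 1 / (2 * real (colour_number v CARD('d)))"
  have C: "0 < C"
    by (simp add: C_def colour_number_def del: of_nat_Suc)
  have cov_G: "covering_family M (\<lambda>n. sup_ball (x n) (r n)) C (G p)" for p
    unfolding C_def
  proof (rule covering_family_if_limsup_full[OF finite_measure_axioms M(2) v r])
    have lower: "AE z in M. eventually (\<lambda>n. z \<in> sup_ball (x n) (v * r n) \<longrightarrow> a p \<le> \<rho> n) sequentially"
    proof (cases "a p = - \<infinity>")
      case False
      then show ?thesis
        using a(2)[of p] unfolding \<rho>_def
        by (intro AE_log_ratio_ge[OF finite_measure_axioms M(2) v r]) auto
    qed simp
    have upper: "AE z in M. eventually (\<lambda>n. z \<in> sup_ball (x n) (v * r n) \<longrightarrow> \<rho> n \<le> b p) sequentially"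
    proof (cases "b p = \<infinity>")
      case False
      then show ?thesis
        using b(2)[of p] unfolding \<rho>_def
        by (intro AE_log_ratio_le[OF finite_measure_axioms M(2) v r]) auto
    qed simp
    show "AE z in M. \<forall>g. \<exists>n\<ge>g. n \<in> G p \<and> z \<in> sup_ball (x n) (v * r n)"
      using limsup_AE lower upper
    proof eventually_elim
      case (elim z)
      then have "eventually (\<lambda>n. z \<in> sup_ball (x n) (v * r n) \<longrightarrow> n \<in> G p) sequentially"
        unfolding G_def by eventually_elim simp
      then obtain h where h: "\<And>n. h \<le> n \<Longrightarrow> z \<in> sup_ball (x n) (v * r n) \<Longrightarrow> n \<in> G p"
        by (auto simp: eventually_sequentially)
      show ?case
      proof
        fix g
        obtain n where "max g h \<le> n" "z \<in> sup_ball (x n) (v * r n)"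
          using elim(1) by blast
        then show "\<exists>n\<ge>g. n \<in> G p \<and> z \<in> sup_ball (x n) (v * r n)"
          using h by auto
      qed
    qed
  qed
  obtain F :: "nat \<Rightarrow> nat \<Rightarrow> nat set" where
    F: "\<And>p i. finite (F p i)" "\<And>p i. F p i \<subseteq> G p"
      "\<And>p i. disjoint_family_on (\<lambda>n. sup_ball (x n) (r n)) (F p i)"
      "\<And>p i n. n \<in> F p i \<Longrightarrow> r n < 2 powr (- real p)"
      "\<And>p q i j m n. p < q \<Longrightarrow> i \<le> p \<Longrightarrow> m \<in> F p i \<Longrightarrow> n \<in> F q j \<Longrightarrow> 2 * r n < r m"
    and cov: "covering_family M (\<lambda>n. sup_ball (x n) (r n)) (C / 2) (\<Union>p. \<Union>i\<le>p. F p i)"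
    by (rule sparse_covering_family[where G = G and r = r,
        OF finite_measure_axioms M(2) cov_G less_imp_le[OF C] r]) (rule that)
  define I where "I = (\<Union>p. \<Union>i\<le>p. F p i)"
  let ?\<phi> = "enumerate I"
  have inf: "infinite I" and sub: "asymptotically_covering M (x \<circ> ?\<phi>) (r \<circ> ?\<phi>)"
    using asymptotically_covering_subsequence[OF M _ cov] C unfolding I_def by auto
  \<comment> \<open>Only finitely many indices are picked before stage \<open>p\<close>, and \<open>G\<close> is decreasing.\<close>
  have ev_G: "eventually (\<lambda>n. ?\<phi> n \<in> G p) sequentially" for p
  proof -
    have G_mono: "G q \<subseteq> G p" if "p \<le> q" for q
      using incseqD[OF a(1) that] decseqD[OF b(1) that] unfolding G_def by (auto intro: order_trans)
    have "I - G p \<subseteq> (\<Union>q<p. \<Union>i\<le>q. F q i)"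
    proof
      fix n assume n: "n \<in> I - G p"
      then obtain q i where q: "i \<le> q" "n \<in> F q i"
        by (auto simp: I_def)
      then have "q < p"
        using n F(2) G_mono by (meson DiffD2 not_le subsetD)
      then show "n \<in> (\<Union>q<p. \<Union>i\<le>q. F q i)"
        using q by blast
    qed
    then have "finite (I - G p)"
      by (rule finite_subset) (use F(1) in auto)
    then obtain h where h: "I - G p \<subseteq> {..<h}"
      using finite_nat_bounded by blast
    have "?\<phi> n \<in> G p" if "h \<le> n" for n
    proof -
      have "n \<le> ?\<phi> n"
        using inf by (rule le_enumerate)
      then have "?\<phi> n \<notin> {..<h}"
        using that by simp
      then show ?thesis
        using h enumerate_in_set[OF inf, of n] by blast
    qed
    then show ?thesis
      by (auto simp: eventually_sequentially)
  qed
  have "a p \<le> liminf (\<lambda>n. \<rho> (?\<phi> n))" for p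
    using ev_G[of p] by (intro Liminf_bounded) (auto simp: G_def elim: eventually_mono)
  then have "lower_dim_H M \<le> liminf (\<lambda>n. \<rho> (?\<phi> n))"
    using a(3) by (intro LIMSEQ_le_const2) auto
  moreover have "limsup (\<lambda>n. \<rho> (?\<phi> n)) \<le> b p" for p
    using ev_G[of p] by (intro Limsup_bounded) (auto simp: G_def elim: eventually_mono)
  then have "limsup (\<lambda>n. \<rho> (?\<phi> n)) \<le> upper_dim_P M"
    using b(3) by (intro LIMSEQ_le_const) auto
  ultimately show ?thesis
    using sub strict_mono_enumerate[OF inf] by blast
qed

theorem theorem2p3:
  fixes M :: "(real ^ 'd) measure"
    and x :: "nat \<Rightarrow> real ^ 'd" and r :: "nat \<Rightarrow> real"
  assumes "prob_space M" and "sets M = sets borel"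
    and "\<And>n. r n > 0"
    and "inj (\<lambda>n. sup_ball (x n) (r n))"
    and "(\<lambda>n. sup_diameter (sup_ball (x n) (r n))) \<longlonglongrightarrow> 0"
  shows "(asymptotically_covering M x r \<longrightarrow>
            (\<exists>\<phi> :: nat \<Rightarrow> nat. strict_mono \<phi> \<and>
               asymptotically_covering M (x \<circ> \<phi>) (r \<circ> \<phi>) \<and>
               weakly_redundant (x \<circ> \<phi>) (r \<circ> \<phi>)))
       \<and> ((\<exists>v::real. 0 \<le> v \<and> v < 1 \<and>
              measure M (\<Inter>g. \<Union>n\<in>{g..}. sup_ball (x n) (v * r n)) = 1) \<longrightarrow>
            (\<exists>\<phi> :: nat \<Rightarrow> nat. strict_mono \<phi> \<and>
               asymptotically_covering M (x \<circ> \<phi>) (r \<circ> \<phi>) \<and>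
               lower_dim_H M
                 \<le> liminf (\<lambda>n. log_ratio (measure M (sup_ball (x (\<phi> n)) (r (\<phi> n))))
                                          (sup_diameter (sup_ball (x (\<phi> n)) (r (\<phi> n))))) \<and>
               liminf (\<lambda>n. log_ratio (measure M (sup_ball (x (\<phi> n)) (r (\<phi> n))))
                                      (sup_diameter (sup_ball (x (\<phi> n)) (r (\<phi> n)))))
                 \<le> limsup (\<lambda>n. log_ratio (measure M (sup_ball (x (\<phi> n)) (r (\<phi> n))))
                                          (sup_diameter (sup_ball (x (\<phi> n)) (r (\<phi> n))))) \<and>
               limsup (\<lambda>n. log_ratio (measure M (sup_ball (x (\<phi> n)) (r (\<phi> n))))
                                      (sup_diameter (sup_ball (x (\<phi> n)) (r (\<phi> n)))))
                 \<le> upper_dim_P M))"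
proof -
  have diam: "sup_diameter (sup_ball (x n) (r n)) = 2 * r n" for n
    using assms(3)[of n] by (intro sup_diameter_sup_ball) simp
  have "r \<longlonglongrightarrow> 0"
    using tendsto_mult_left[OF assms(5), of "1 / 2"] by (simp add: diam)
  note hyps = assms(1-3) this
  show ?thesis (is "_ \<and> (_ \<longrightarrow> ?dims)")
  proof (intro conjI impI)
    assume "asymptotically_covering M x r"
    then show "\<exists>\<phi> :: nat \<Rightarrow> nat. strict_mono \<phi> \<and>
        asymptotically_covering M (x \<circ> \<phi>) (r \<circ> \<phi>) \<and> weakly_redundant (x \<circ> \<phi>) (r \<circ> \<phi>)"
      by (rule covering_subsequence_weakly_redundant[OF hyps])
  next
    assume "\<exists>v. 0 \<le> v \<and> v < 1 \<and> measure M (\<Inter>g. \<Union>n\<in>{g..}. sup_ball (x n) (v * r n)) = 1"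
    then obtain v where "0 \<le> v" "v < 1"
        "measure M (\<Inter>g. \<Union>n\<in>{g..}. sup_ball (x n) (v * r n)) = 1"
      by blast
    from covering_subsequence_dimension_bounds[OF hyps this] show ?dims
      unfolding diam using Liminf_le_Limsup[OF sequentially_bot] by blast
  qed
qed

end
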